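(* Let $p\ge 3$ and let $G$ be a primitive permutation group on a finite set $X$. Then $G$ synchronizes every transformation on $X$ of kernel type $(p,3,1,\dots,1)$.
   Context: A permutation group $G$ on $X$ is primitive if it is transitive and preserves no equivalence relation on $X$ other than equality and the universal relation. A map has kernel type $(p,3,1,\dots,1)$ if it has one kernel class (non-empty fibre) of size $p$, another of size $3$, and all other kernel classes are singletons (in arbitrary number). $G$ synchronizes $f$ if the transformation semigroup $\langle G,f\rangle$ contains a constant map. *)

theory Defs
  imports "HOL-Algebra.Group_Action" "HOL-Library.Multiset"
begin

(* A transformation of X is an element of X \<rightarrow>\<^sub>E X: as in the library's BijGroup, functions
   are extensional, so that equality of functions is equality on X. *)

definition permutation_group :: "'a set \<Rightarrow> ('a \<Rightarrow> 'a) set \<Rightarrow> bool" where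
  "permutation_group X G \<longleftrightarrow> subgroup G (BijGroup X)"

definition transitive_permutation_group :: "'a set \<Rightarrow> ('a \<Rightarrow> 'a) set \<Rightarrow> bool" where
  "transitive_permutation_group X G \<longleftrightarrow>
     permutation_group X G \<and> transitive_action (BijGroup X\<lparr>carrier := G\<rparr>) X (\<lambda>g. g)"

definition preserves_relation :: "('a \<Rightarrow> 'a) set \<Rightarrow> ('a \<times> 'a) set \<Rightarrow> bool" where
  "preserves_relation G r \<longleftrightarrow> (\<forall>g\<in>G. \<forall>(x, y)\<in>r. (g x, g y) \<in> r)"

definition primitive_permutation_group :: "'a set \<Rightarrow> ('a \<Rightarrow> 'a) set \<Rightarrow> bool" where
  "primitive_permutation_group X G \<longleftrightarrow>
     transitive_permutation_group X G \<and>
     (\<forall>r. equiv X r \<and> preserves_relation G r \<longrightarrow> r = Id_on X \<or> r = X \<times> X)"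

definition kernel_classes :: "'a set \<Rightarrow> ('a \<Rightarrow> 'b) \<Rightarrow> 'a set set" where
  "kernel_classes X f = (\<lambda>y. {x \<in> X. f x = y}) ` (f ` X)"

(* The sizes of the kernel classes, counted with multiplicity; intended for finite X
   (mset_set is empty on an infinite set). *)
definition kernel_type :: "'a set \<Rightarrow> ('a \<Rightarrow> 'b) \<Rightarrow> nat multiset" where
  "kernel_type X f = image_mset card (mset_set (kernel_classes X f))"

inductive_set generated_semigroup :: "'a set \<Rightarrow> ('a \<Rightarrow> 'a) set \<Rightarrow> ('a \<Rightarrow> 'a) set"
  for X :: "'a set" and S :: "('a \<Rightarrow> 'a) set" where
  generator: "s \<in> S \<Longrightarrow> s \<in> generated_semigroup X S"
| product: "s \<in> generated_semigroup X S \<Longrightarrow> t \<in> generated_semigroup X S \<Longrightarrow>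
    compose X s t \<in> generated_semigroup X S"

definition constant_map :: "'a set \<Rightarrow> ('a \<Rightarrow> 'a) \<Rightarrow> bool" where
  "constant_map X h \<longleftrightarrow> (\<exists>c\<in>X. \<forall>x\<in>X. h x = c)"

definition synchronizes :: "'a set \<Rightarrow> ('a \<Rightarrow> 'a) set \<Rightarrow> ('a \<Rightarrow> 'a) \<Rightarrow> bool" where
  "synchronizes X G f \<longleftrightarrow> (\<exists>h \<in> generated_semigroup X (insert f G). constant_map X h)"

end

theory Submission
  imports Defs
begin

text \<open>
  The proof shows more: a primitive group synchronizes every map that has exactly two
  non-singleton kernel classes \<open>A\<close> and \<open>B\<close>, whatever their sizes.

  Suppose that the semigroup \<open>S\<close> generated by \<open>G\<close> and \<open>f\<close> contains no constant map. Consider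
  the elements of minimal rank in \<open>S\<close> and the family of their images. Every element of \<open>S\<close> maps
  each of these images bijectively onto another one, by minimality of the rank, so every image
  meets each kernel class of every minimal map in exactly one point. By transitivity, all points lie in the same positive
  number \<open>d\<close> of images. By primitivity, any two points are separated by some minimal map, and no
  two points lie in exactly the same images; otherwise an invariant equivalence relation would
  be universal.

  The contradiction comes from counting images. Each image meets \<open>A\<close> in at most one point, so
  \<open>card A * d\<close> images meet \<open>A\<close>. Such an image \<open>K\<close> is determined by \<open>f ` K\<close>, which is one of
  the \<open>d\<close> images through the point \<open>f ` A\<close>, together with its trace on \<open>B\<close>
  (\<open>transversal_determined\<close>). Whether the trace is empty can be read off from \<open>f ` K\<close>, so for each
  value of \<open>f ` K\<close> there are at most \<open>card B\<close> possibilities for \<open>K\<close>. Therefore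
  \<open>card A \<le> card B\<close>, and by symmetry equality holds and every possibility occurs: the point
  of \<open>K\<close> in \<open>A\<close> can be traded for one in \<open>B\<close>, any prescribed one, without touching the rest of
  \<open>K\<close> outside \<open>A\<close> and \<open>B\<close> (\<open>transversal_through\<close>). Such trades show that points outside \<open>A\<close> and
  \<open>B\<close> cannot tell two points of \<open>A\<close> apart, so an image through \<open>a \<in> A\<close> must
  contain a point \<open>b \<in> B\<close> that shares no image with the rest of \<open>A\<close> (\<open>private_partner\<close>). Using this
  in both directions, \<open>a\<close> and \<open>b\<close> lie in exactly the same images (\<open>inseparable_pair\<close>), which
  primitivity forbids.
\<close>

section \<open>Families of transversals and maps with two large fibres\<close>

lemma other_element:
  assumes "card A \<ge> 2"
  shows "\<exists>x\<in>A. x \<noteq> a"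
proof -
  have "\<not> A \<subseteq> {a}"
    using card_mono[of "{a}" A] assms by auto
  then show ?thesis by blast
qed

text \<open>
  The combinatorial content of the situation, free of groups and semigroups: a set \<open>K \<in> \<K>\<close> is a
  transversal for the kernel of each \<open>h \<in> H\<close>. In the application \<open>\<K>\<close> consists of the images and
  \<open>H\<close> of the maps of minimal rank. Points sharing a member of \<open>\<K>\<close> may be thought of as adjacent
  in a graph, of which \<open>\<K>\<close> is a family of maximum cliques and \<open>H\<close> a family of optimal colourings.
\<close>

locale transversal_system =
  fixes X :: "'a set" and \<K> :: "'a set set" and H :: "('a \<Rightarrow> 'b) set" and d :: nat
  assumes finite_points: "finite X"
    and transversal_subset: "K \<in> \<K> \<Longrightarrow> K \<subseteq> X"
    and transversal_inj: "K \<in> \<K> \<Longrightarrow> h \<in> H \<Longrightarrow> inj_on h K"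
    and transversal_onto: "K \<in> \<K> \<Longrightarrow> h \<in> H \<Longrightarrow> h ` K = h ` X"
    and separating: "x \<in> X \<Longrightarrow> y \<in> X \<Longrightarrow> x \<noteq> y \<Longrightarrow> \<exists>h\<in>H. h x \<noteq> h y"
    and degree: "x \<in> X \<Longrightarrow> card {K \<in> \<K>. x \<in> K} = d"
    and degree_pos: "d > 0"
begin

lemma finite_transversals: "finite \<K>"
  using finite_points transversal_subset by (meson PowI finite_Pow_iff finite_subset subsetI)

lemma point_covered:
  assumes "x \<in> X"
  obtains K where "K \<in> \<K>" "x \<in> K"
proof -
  have "card {K \<in> \<K>. x \<in> K} \<noteq> 0"
    using degree[OF assms] degree_pos by simp
  then have "{K \<in> \<K>. x \<in> K} \<noteq> {}"
    by (metis card.empty)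
  with that show ?thesis by blast
qed

text \<open>
  The point \<open>z\<close> is the one at which \<open>K\<close> meets the kernel class of \<open>y\<close> for a map \<open>h\<close> separating
  \<open>x\<close> from \<open>y\<close>. In graph terms, with \<open>x \<in> K\<close>: some neighbour of \<open>x\<close> in \<open>K\<close> is not a neighbour
  of \<open>y\<close>.
\<close>

lemma separating_point:
  assumes "K \<in> \<K>" "x \<in> X" "y \<in> X" "x \<noteq> y"
  obtains z where "z \<in> K" "z \<noteq> x" "\<And>K'. K' \<in> \<K> \<Longrightarrow> z \<in> K' \<Longrightarrow> y \<in> K' \<Longrightarrow> z = y"
proof -
  obtain h where h: "h \<in> H" "h x \<noteq> h y"
    using separating assms by blast
  have "h y \<in> h ` K"
    using transversal_onto[OF assms(1) h(1)] assms(3) by simp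
  then obtain z where z: "z \<in> K" "h z = h y"
    by auto
  have "z = y" if "K' \<in> \<K>" "z \<in> K'" "y \<in> K'" for K'
    using transversal_inj[OF that(1) h(1)] that z(2) by (auto dest: inj_onD)
  with z h that show ?thesis by metis
qed

end

locale two_fibre_map = transversal_system X \<K> H d
  for X :: "'a set" and \<K> and H :: "('a \<Rightarrow> 'b) set" and d +
  fixes f :: "'a \<Rightarrow> 'a" and A B :: "'a set"
  assumes maps_points: "x \<in> X \<Longrightarrow> f x \<in> X"
    and maps_transversals: "K \<in> \<K> \<Longrightarrow> f ` K \<in> \<K>"
    and inj_on_transversal: "K \<in> \<K> \<Longrightarrow> inj_on f K"
    and fibres_subset: "A \<subseteq> X" "B \<subseteq> X"
    and fibres_disjoint: "A \<inter> B = {}"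
    and fibres_large: "card A \<ge> 2" "card B \<ge> 2"
    and fibres: "x \<in> X \<Longrightarrow> y \<in> X \<Longrightarrow>
      f x = f y \<longleftrightarrow> x = y \<or> x \<in> A \<and> y \<in> A \<or> x \<in> B \<and> y \<in> B"
begin

text \<open>
  The assumptions are symmetric in the two fibres, so that each result below also holds with
  \<open>A\<close> and \<open>B\<close> exchanged.
\<close>

lemma swap_fibres: "two_fibre_map X \<K> H d f B A"
  using maps_points maps_transversals inj_on_transversal fibres_subset fibres_disjoint
    fibres_large fibres
  by unfold_locales blast+

lemma fibre_meets_once:
  assumes "K \<in> \<K>" "x \<in> K" "y \<in> K" "x \<in> A" "y \<in> A"
  shows "x = y"
  using inj_on_transversal[OF assms(1)] assms fibres fibres_subset by (meson inj_onD subsetD)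

lemma second_fibre_meets_once:
  assumes "K \<in> \<K>" "x \<in> K" "y \<in> K" "x \<in> B" "y \<in> B"
  shows "x = y"
  using inj_on_transversal[OF assms(1)] assms fibres fibres_subset by (meson inj_onD subsetD)

lemma singleton_fibre_shared:
  assumes "K \<in> \<K>" "K' \<in> \<K>" "f ` K = f ` K'" "x \<in> K" "x \<notin> A" "x \<notin> B"
  shows "x \<in> K'"
proof -
  obtain x' where "x' \<in> K'" "f x = f x'"
    using assms(3,4) by (metis imageE imageI)
  with assms fibres[of x x'] transversal_subset show ?thesis
    by blast
qed

text \<open>
  The image and the trace on \<open>B\<close> determine \<open>K\<close> up to its point \<open>a\<close> in \<open>A\<close>. That point cannot
  vary either: if \<open>K'\<close> had another point \<open>a'\<close> in \<open>A\<close> and otherwise agreed with \<open>K\<close>, every point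
  of \<open>K\<close> other than \<open>a\<close> would share the transversal \<open>K'\<close> with \<open>a'\<close>, and nothing in \<open>K\<close> could
  separate \<open>a'\<close> from \<open>a\<close>.
\<close>

lemma transversal_determined:
  assumes K: "K \<in> \<K>" "a \<in> K" "a \<in> A" and K': "K' \<in> \<K>" "a' \<in> K'" "a' \<in> A"
    and img: "f ` K = f ` K'" and trace: "K \<inter> B = K' \<inter> B"
  shows "K = K'"
proof (cases "a = a'")
  case True
  have "x \<in> K'" if "x \<in> K" for x
    using singleton_fibre_shared[OF K(1) K'(1) img that] fibre_meets_once[OF K(1) that K(2)]
      K(3) K'(2) True trace that by blast
  moreover have "x \<in> K" if "x \<in> K'" for x
    using singleton_fibre_shared[OF K'(1) K(1) img[symmetric] that]
      fibre_meets_once[OF K'(1) that K'(2)] K(2) K'(3) True trace that by blast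
  ultimately show ?thesis by blast
next
  case False
  obtain z where z: "z \<in> K" "z \<noteq> a"
    "\<And>K''. K'' \<in> \<K> \<Longrightarrow> z \<in> K'' \<Longrightarrow> a' \<in> K'' \<Longrightarrow> z = a'"
    using separating_point[OF K(1), of a a'] K K' False fibres_subset by blast
  have "z \<notin> A"
    using fibre_meets_once[OF K(1) z(1) K(2)] z(2) K(3) by blast
  moreover have "z \<in> K'"
    using singleton_fibre_shared[OF K(1) K'(1) img z(1) \<open>z \<notin> A\<close>] trace z(1) by blast
  ultimately show ?thesis
    using z(3)[OF K'(1) _ K'(2)] K'(3) by blast
qed

lemma finite_fibres: "finite A" "finite B"
  using fibres_subset finite_points finite_subset by blast+

lemma card_transversals_meeting: "card {K \<in> \<K>. K \<inter> A \<noteq> {}} = card A * d"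
proof -
  have eq: "{K \<in> \<K>. K \<inter> A \<noteq> {}} = (\<Union>a\<in>A. {K \<in> \<K>. a \<in> K})"
    by blast
  have "card (\<Union>a\<in>A. {K \<in> \<K>. a \<in> K}) = (\<Sum>a\<in>A. card {K \<in> \<K>. a \<in> K})"
    using finite_fibres finite_transversals fibre_meets_once
    by (intro card_UN_disjoint) auto
  also have "\<dots> = card A * d"
    using degree fibres_subset by (simp add: subset_iff)
  finally show ?thesis
    unfolding eq .
qed

text \<open>
  The second component records the trace on \<open>B\<close>, which is a point or empty. Encoding the empty
  trace by a point \<open>b\<^sub>0\<close> of \<open>B\<close> keeps the number of codes at \<open>card B\<close> for each image; this
  loses nothing, because the image already tells whether the trace is empty.
\<close>

definition trace_code :: "'a \<Rightarrow> 'a set \<Rightarrow> 'a set \<times> 'a" where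
  "trace_code b\<^sub>0 K = (f ` K, if K \<inter> B = {} then b\<^sub>0 else (THE b. b \<in> K \<inter> B))"

lemma trace_code_eq:
  assumes "K \<in> \<K>" "b \<in> K" "b \<in> B"
  shows "trace_code b\<^sub>0 K = (f ` K, b)"
proof -
  have "(THE b. b \<in> K \<inter> B) = b"
    using assms second_fibre_meets_once by (intro the_equality) auto
  then show ?thesis
    using assms by (auto simp: trace_code_def)
qed

lemma image_meets_iff:
  assumes "K \<in> \<K>" "b \<in> B"
  shows "f b \<in> f ` K \<longleftrightarrow> K \<inter> B \<noteq> {}"
proof
  assume "f b \<in> f ` K"
  then obtain x where "x \<in> K" "f b = f x"
    by auto
  then show "K \<inter> B \<noteq> {}"
    using fibres[of b x] assms transversal_subset fibres_subset fibres_disjoint by blast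
next
  assume "K \<inter> B \<noteq> {}"
  then obtain x where "x \<in> K" "x \<in> B"
    by blast
  then have "f b = f x"
    using fibres[of b x] assms fibres_subset by blast
  then show "f b \<in> f ` K"
    using \<open>x \<in> K\<close> by simp
qed

lemma inj_trace_code: "inj_on (trace_code b\<^sub>0) {K \<in> \<K>. K \<inter> A \<noteq> {}}"
proof (rule inj_onI)
  fix K K'
  assume K: "K \<in> {K \<in> \<K>. K \<inter> A \<noteq> {}}" and K': "K' \<in> {K \<in> \<K>. K \<inter> A \<noteq> {}}"
    and eq: "trace_code b\<^sub>0 K = trace_code b\<^sub>0 K'"
  have img: "f ` K = f ` K'"
    using eq by (simp add: trace_code_def)
  have "K \<inter> B = K' \<inter> B"
  proof (cases "K \<inter> B = {}")
    case True
    then show ?thesis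
      using image_meets_iff img K K' by blast
  next
    case False
    then obtain b where b: "b \<in> K" "b \<in> B"
      by blast
    then have "K' \<inter> B \<noteq> {}"
      using image_meets_iff img K K' by blast
    then obtain b' where b': "b' \<in> K'" "b' \<in> B"
      by blast
    have "b = b'"
      using eq trace_code_eq[of K b] trace_code_eq[of K' b'] b b' K K' by simp
    then show ?thesis
      using b b' K K' second_fibre_meets_once by blast
  qed
  then show "K = K'"
    using transversal_determined[of K _ K'] K K' img by blast
qed

lemma trace_code_range:
  assumes "a \<in> A" "b\<^sub>0 \<in> B"
  shows "trace_code b\<^sub>0 ` {K \<in> \<K>. K \<inter> A \<noteq> {}} \<subseteq> {M \<in> \<K>. f a \<in> M} \<times> B"
proof (rule image_subsetI)
  fix K assume "K \<in> {K \<in> \<K>. K \<inter> A \<noteq> {}}"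
  then obtain a' where K: "K \<in> \<K>" "a' \<in> K" "a' \<in> A"
    by blast
  have "f a = f a'"
    using fibres[of a a'] assms K fibres_subset by blast
  then have "f ` K \<in> {M \<in> \<K>. f a \<in> M}"
    using K maps_transversals by simp
  moreover have "snd (trace_code b\<^sub>0 K) \<in> B"
  proof (cases "K \<inter> B = {}")
    case True
    then show ?thesis
      using assms by (simp add: trace_code_def)
  next
    case False
    then obtain b where "b \<in> K" "b \<in> B"
      by blast
    then show ?thesis
      using trace_code_eq[OF K(1)] by simp
  qed
  ultimately show "trace_code b\<^sub>0 K \<in> {M \<in> \<K>. f a \<in> M} \<times> B"
    by (simp add: trace_code_def)
qed

lemma card_image_pairs:
  assumes "a \<in> A"
  shows "card ({M \<in> \<K>. f a \<in> M} \<times> B) = card B * d"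
  using assms degree[of "f a"] maps_points fibres_subset
  by (auto simp: card_cartesian_product)

lemma card_fibre_le: "card A \<le> card B"
proof -
  obtain a b where ab: "a \<in> A" "b \<in> B"
    using other_element[OF fibres_large(1)] other_element[OF fibres_large(2)] by blast
  have "card A * d \<le> card ({M \<in> \<K>. f a \<in> M} \<times> B)"
    unfolding card_transversals_meeting[symmetric]
    by (rule card_inj_on_le[OF inj_trace_code trace_code_range[OF ab]])
      (simp add: finite_transversals finite_fibres)
  then have "card A * d \<le> card B * d"
    unfolding card_image_pairs[OF ab(1)] .
  then show ?thesis
    using degree_pos by simp
qed

text \<open>
  As the fibres have equal size, the counting estimate is sharp and all codes occur. Taking the
  default point \<open>b\<^sub>0\<close> different from \<open>b\<close> ensures that the code \<open>(f ` K, b)\<close> comes from a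
  transversal that really passes through \<open>b\<close>.
\<close>

lemma transversal_through:
  assumes K: "K \<in> \<K>" "a \<in> K" "a \<in> A" and b: "b \<in> B"
  shows "\<exists>K'\<in>\<K>. b \<in> K' \<and> f ` K' = f ` K"
proof -
  interpret swap: two_fibre_map X \<K> H d f B A
    by (rule swap_fibres)
  obtain b\<^sub>0 where b0: "b\<^sub>0 \<in> B" "b\<^sub>0 \<noteq> b"
    using other_element[OF fibres_large(2)] by blast
  let ?S = "{K \<in> \<K>. K \<inter> A \<noteq> {}}" and ?T = "{M \<in> \<K>. f a \<in> M} \<times> B"
  have "card A = card B"
    using card_fibre_le swap.card_fibre_le by simp
  then have "card (trace_code b\<^sub>0 ` ?S) = card ?T"
    using card_image[OF inj_trace_code] card_transversals_meeting card_image_pairs[OF K(3)]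
    by simp
  then have "trace_code b\<^sub>0 ` ?S = ?T"
    by (intro card_subset_eq trace_code_range[OF K(3) b0(1)])
      (simp_all add: finite_transversals finite_fibres)
  moreover have "(f ` K, b) \<in> ?T"
    using K b maps_transversals by auto
  ultimately have "(f ` K, b) \<in> trace_code b\<^sub>0 ` ?S"
    by simp
  then obtain K' where K': "K' \<in> \<K>" "trace_code b\<^sub>0 K' = (f ` K, b)"
    by (metis (no_types, lifting) imageE mem_Collect_eq)
  have "K' \<inter> B \<noteq> {}"
    using K'(2) b0(2) by (auto simp: trace_code_def)
  then obtain b' where "b' \<in> K'" "b' \<in> B"
    by blast
  with K' trace_code_eq[of K' b' b\<^sub>0] have "b \<in> K'" "f ` K' = f ` K"
    by auto
  with K' show ?thesis by blast
qed

text \<open>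
  For any other point \<open>a'\<close> of \<open>A\<close>, the transversal \<open>K\<close> contains a point \<open>z\<close> that shares no
  transversal with \<open>a'\<close>. If \<open>z\<close> were outside \<open>B\<close>, two trades, from \<open>a\<close> to a point of \<open>B\<close> and from
  there to \<open>a'\<close>, would produce a transversal through \<open>z\<close> and \<open>a'\<close>. Hence \<open>z\<close> is
  the only point of \<open>K\<close> in \<open>B\<close>, and so it is the same for all choices of \<open>a'\<close>.
\<close>

lemma private_partner:
  assumes K: "K \<in> \<K>" "a \<in> K" "a \<in> A"
  shows "\<exists>b \<in> K \<inter> B. \<forall>K'\<in>\<K>. b \<in> K' \<longrightarrow> K' \<inter> A \<subseteq> {a}"
proof -
  interpret swap: two_fibre_map X \<K> H d f B A
    by (rule swap_fibres)
  have partner: "\<exists>b. b \<in> K \<and> b \<in> B \<and> (\<forall>K'\<in>\<K>. \<not> (b \<in> K' \<and> a' \<in> K'))"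
    if a': "a' \<in> A" "a' \<noteq> a" for a'
  proof -
    obtain z where z: "z \<in> K" "z \<noteq> a"
      "\<And>K'. K' \<in> \<K> \<Longrightarrow> z \<in> K' \<Longrightarrow> a' \<in> K' \<Longrightarrow> z = a'"
      using separating_point[OF K(1), of a a'] K a' fibres_subset by blast
    have zA: "z \<notin> A"
      using fibre_meets_once[OF K(1) z(1) K(2)] z(2) K(3) by blast
    have "z \<in> B"
    proof (rule ccontr)
      assume zB: "z \<notin> B"
      obtain b where b: "b \<in> B"
        using other_element[OF fibres_large(2)] by blast
      obtain K1 where K1: "K1 \<in> \<K>" "b \<in> K1" "f ` K1 = f ` K"
        using transversal_through[OF K b] by blast
      obtain K2 where K2: "K2 \<in> \<K>" "a' \<in> K2" "f ` K2 = f ` K1"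
        using swap.transversal_through[OF K1(1,2) b a'(1)] by blast
      have "z \<in> K2"
        using singleton_fibre_shared[OF K(1) K2(1) _ z(1) zA zB] K1 K2 by simp
      then show False
        using z(3)[OF K2(1) _ K2(2)] zA a'(1) by blast
    qed
    then show ?thesis
      using z zA a'(1) by blast
  qed
  obtain a\<^sub>0 where "a\<^sub>0 \<in> A" "a\<^sub>0 \<noteq> a"
    using other_element[OF fibres_large(1)] by blast
  then obtain b where b: "b \<in> K" "b \<in> B"
    using partner by blast
  have "a' = a" if "K' \<in> \<K>" "b \<in> K'" "a' \<in> K'" "a' \<in> A" for K' a'
    using partner[OF that(4)] second_fibre_meets_once[OF K(1) b(1) _ b(2)] that by blast
  with b show ?thesis by blast
qed

text \<open>
  The private partner \<open>b\<close> of \<open>a\<close> in a transversal \<open>K\<close> has itself a private partner in \<open>K\<close>, which can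
  only be \<open>a\<close>. A transversal through \<open>a\<close> meets \<open>B\<close>, hence in \<open>b\<close>, and conversely.
\<close>

theorem inseparable_pair:
  "\<exists>a\<in>A. \<exists>b\<in>B. \<forall>K\<in>\<K>. a \<in> K \<longleftrightarrow> b \<in> K"
proof -
  interpret swap: two_fibre_map X \<K> H d f B A
    by (rule swap_fibres)
  obtain a where a: "a \<in> A"
    using other_element[OF fibres_large(1)] by blast
  obtain K where K: "K \<in> \<K>" "a \<in> K"
    using point_covered a fibres_subset by blast
  obtain b where b: "b \<in> K" "b \<in> B" "\<forall>K'\<in>\<K>. b \<in> K' \<longrightarrow> K' \<inter> A \<subseteq> {a}"
    using private_partner[OF K a] by blast
  obtain a' where a': "a' \<in> K" "a' \<in> A" "\<forall>K'\<in>\<K>. a' \<in> K' \<longrightarrow> K' \<inter> B \<subseteq> {b}"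
    using swap.private_partner[OF K(1) b(1,2)] by blast
  have "a' = a"
    using fibre_meets_once[OF K(1) a'(1) K(2) a'(2) a] .
  have "a \<in> K' \<longleftrightarrow> b \<in> K'" if K': "K' \<in> \<K>" for K'
  proof
    assume aK': "a \<in> K'"
    then obtain b' where "b' \<in> K'" "b' \<in> B"
      using private_partner[OF K' aK' a] by blast
    then show "b \<in> K'"
      using a'(3) K' aK' \<open>a' = a\<close> by blast
  next
    assume bK': "b \<in> K'"
    then obtain a'' where "a'' \<in> K'" "a'' \<in> A"
      using swap.private_partner[OF K' bK' b(2)] by blast
    then show "a \<in> K'"
      using b(3) K' bK' by blast
  qed
  with a b(2) show ?thesis by blast
qed

end

section \<open>Minimal images of a non-synchronizing semigroup\<close>

lemma permutation_group_bij:
  assumes "permutation_group X G" "g \<in> G"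
  shows "bij_betw g X X"
proof -
  have "G \<subseteq> carrier (BijGroup X)"
    using assms(1) unfolding permutation_group_def by (rule subgroup.subset)
  with assms(2) show ?thesis
    by (auto simp: BijGroup_def Bij_def)
qed

lemma primitive_group_bij:
  "primitive_permutation_group X G \<Longrightarrow> g \<in> G \<Longrightarrow> bij_betw g X X"
  using permutation_group_bij
  unfolding primitive_permutation_group_def transitive_permutation_group_def by blast

lemma primitive_group_maps:
  assumes "primitive_permutation_group X G" "g \<in> G" "x \<in> X"
  shows "g x \<in> X"
  using primitive_group_bij[OF assms(1,2)] assms(3) by (rule bij_betw_apply)

lemma primitive_group_transitive:
  assumes "primitive_permutation_group X G" "x \<in> X" "y \<in> X"
  obtains g where "g \<in> G" "g x = y"
  using assms transitive_action.unique_orbit[of "BijGroup X\<lparr>carrier := G\<rparr>" X "\<lambda>g. g" x y]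
  unfolding primitive_permutation_group_def transitive_permutation_group_def by auto

text \<open>
  Primitivity in the form in which it is used: an invariant equivalence relation, given as a
  predicate, that relates some two distinct points relates all points.
\<close>

lemma primitive_group_relation:
  assumes "primitive_permutation_group X G"
    and "\<And>x. x \<in> X \<Longrightarrow> R x x" "\<And>x y. R x y \<Longrightarrow> R y x"
    and "\<And>x y z. R x y \<Longrightarrow> R y z \<Longrightarrow> R x z"
    and inv: "\<And>g x y. g \<in> G \<Longrightarrow> x \<in> X \<Longrightarrow> y \<in> X \<Longrightarrow> R x y \<Longrightarrow> R (g x) (g y)"
    and xy: "x \<in> X" "y \<in> X" "x \<noteq> y" "R x y"
    and uv: "u \<in> X" "v \<in> X"
  shows "R u v"
proof -
  let ?r = "{(x, y). x \<in> X \<and> y \<in> X \<and> R x y}"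
  have "equiv X ?r"
  proof (rule equivI)
    show "?r \<subseteq> X \<times> X" by blast
    show "refl_on X ?r" using assms(2) by (auto simp: refl_on_def)
    show "sym ?r" using assms(3) by (auto simp: sym_def)
    show "trans ?r" using assms(4) by (blast intro: transI)
  qed
  moreover have "preserves_relation G ?r"
    using inv primitive_group_maps[OF assms(1)]
    by (auto simp: preserves_relation_def)
  ultimately have "?r = Id_on X \<or> ?r = X \<times> X"
    using assms(1) unfolding primitive_permutation_group_def by blast
  moreover have "(x, y) \<in> ?r" "(x, y) \<notin> Id_on X"
    using xy by auto
  ultimately show ?thesis
    using uv by blast
qed

locale nonsynchronized_map =
  fixes X :: "'a set" and G :: "('a \<Rightarrow> 'a) set" and f :: "'a \<Rightarrow> 'a"
  assumes finite_X: "finite X" and nonempty_X: "X \<noteq> {}"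
    and primitive: "primitive_permutation_group X G"
    and map_f: "f \<in> X \<rightarrow> X"
    and not_synchronizes: "\<not> synchronizes X G f"
begin

abbreviation semigroup :: "('a \<Rightarrow> 'a) set" where
  "semigroup \<equiv> generated_semigroup X (insert f G)"

definition min_rank :: nat where
  "min_rank = (LEAST r. \<exists>s\<in>semigroup. card (s ` X) = r)"

definition minimal_maps :: "('a \<Rightarrow> 'a) set" where
  "minimal_maps = {s \<in> semigroup. card (s ` X) = min_rank}"

definition minimal_images :: "'a set set" where
  "minimal_images = (\<lambda>s. s ` X) ` minimal_maps"

lemma semigroup_maps:
  assumes "s \<in> semigroup" "x \<in> X"
  shows "s x \<in> X"
  using assms
proof (induction arbitrary: x)
  case (generator s)
  then show ?case
    using map_f primitive_group_maps[OF primitive] by auto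
next
  case (product s t)
  then show ?case by (simp add: compose_eq)
qed

lemma compose_image: "compose X s t ` X = s ` t ` X"
  by (auto simp: compose_def)

lemma min_rank_le: "s \<in> semigroup \<Longrightarrow> min_rank \<le> card (s ` X)"
  unfolding min_rank_def by (rule Least_le) blast

lemma minimal_map_exists: "\<exists>s. s \<in> minimal_maps"
proof -
  have "\<exists>r. \<exists>s\<in>semigroup. card (s ` X) = r"
    using generated_semigroup.generator[of f "insert f G"] by blast
  from LeastI_ex[OF this] show ?thesis
    unfolding minimal_maps_def min_rank_def by blast
qed

lemma card_minimal_image: "K \<in> minimal_images \<Longrightarrow> card K = min_rank"
  unfolding minimal_images_def minimal_maps_def by auto

lemma minimal_image_subset: "K \<in> minimal_images \<Longrightarrow> K \<subseteq> X"
  unfolding minimal_images_def minimal_maps_def using semigroup_maps by auto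

text \<open>If \<open>K\<close> is the image of \<open>t\<close>, a collapse of \<open>K\<close> by \<open>s\<close> would give \<open>s \<circ> t\<close> too small a rank.\<close>

lemma
  assumes "s \<in> semigroup" "K \<in> minimal_images"
  shows image_minimal_image: "s ` K \<in> minimal_images"
    and inj_on_minimal_image: "inj_on s K"
proof -
  obtain t where t: "t \<in> semigroup" "K = t ` X" "card K = min_rank"
    using assms(2) unfolding minimal_images_def minimal_maps_def by auto
  have st: "compose X s t \<in> semigroup"
    using assms(1) t(1) by (rule generated_semigroup.product)
  have fin: "finite K"
    using finite_X t(2) by simp
  have "min_rank \<le> card (s ` K)"
    using min_rank_le[OF st] compose_image t(2) by metis
  then have card: "card (s ` K) = card K"
    using card_image_le[OF fin, of s] t(3) by simp
  then show "inj_on s K"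
    using fin by (rule eq_card_imp_inj_on[rotated])
  have "compose X s t \<in> minimal_maps"
    using st card t compose_image[of s t] unfolding minimal_maps_def by simp
  then show "s ` K \<in> minimal_images"
    unfolding minimal_images_def using compose_image t(2) by (metis imageI)
qed

lemma minimal_map_onto:
  assumes "h \<in> minimal_maps" "K \<in> minimal_images"
  shows "h ` K = h ` X"
proof (rule card_subset_eq)
  have h: "h \<in> semigroup" "card (h ` X) = min_rank"
    using assms(1) unfolding minimal_maps_def by auto
  show "finite (h ` X)" using finite_X by simp
  show "h ` K \<subseteq> h ` X" using minimal_image_subset[OF assms(2)] by blast
  show "card (h ` K) = card (h ` X)"
    using card_minimal_image[OF image_minimal_image[OF h(1) assms(2)]] h(2) by simp
qed

lemma group_in_semigroup: "g \<in> G \<Longrightarrow> g \<in> semigroup"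
  by (simp add: generated_semigroup.generator)

lemma min_rank_ge_2: "min_rank \<ge> 2"
proof (rule ccontr)
  assume "\<not> min_rank \<ge> 2"
  obtain s where s: "s \<in> semigroup" "card (s ` X) = min_rank"
    using minimal_map_exists unfolding minimal_maps_def by auto
  have "card (s ` X) \<noteq> 0"
    using finite_X nonempty_X by simp
  with \<open>\<not> min_rank \<ge> 2\<close> s(2) have "card (s ` X) = 1"
    by simp
  then obtain c where c: "s ` X = {c}"
    by (meson card_1_singletonE)
  moreover have "c \<in> X"
    using c semigroup_maps[OF s(1)] by (metis imageE insertI1)
  moreover have "s x = c" if "x \<in> X" for x
    using c imageI[OF that, of s] by simp
  ultimately have "constant_map X s"
    unfolding constant_map_def by blast
  with s(1) not_synchronizes show False
    unfolding synchronizes_def by blast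
qed

text \<open>
  Having the same value under all minimal maps is an invariant relation, because minimal maps
  remain minimal when preceded by a permutation. Were it universal, minimal maps would be
  constant.
\<close>

lemma minimal_maps_separate:
  assumes "x \<in> X" "y \<in> X" "x \<noteq> y"
  shows "\<exists>h\<in>minimal_maps. h x \<noteq> h y"
proof (rule ccontr)
  assume same: "\<not> ?thesis"
  have all: "\<forall>h\<in>minimal_maps. h u = h v" if "u \<in> X" "v \<in> X" for u v
  proof (rule primitive_group_relation[OF primitive,
          where R = "\<lambda>u v. \<forall>h\<in>minimal_maps. h u = h v" and x = x and y = y])
    fix g u v
    assume g: "g \<in> G" and uv: "u \<in> X" "v \<in> X" and eq: "\<forall>h\<in>minimal_maps. h u = h v"
    have "g ` X = X"
      using primitive_group_bij[OF primitive g] by (rule bij_betw_imp_surj_on)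
    then have "compose X h g \<in> minimal_maps" if "h \<in> minimal_maps" for h
      using that group_in_semigroup[OF g] compose_image[of h g]
      unfolding minimal_maps_def by (auto intro: generated_semigroup.product)
    with eq uv show "\<forall>h\<in>minimal_maps. h (g u) = h (g v)"
      by (metis compose_eq)
  qed (use assms same that in auto)
  obtain h where h: "h \<in> minimal_maps"
    using minimal_map_exists by blast
  have "card (h ` X) \<le> 1"
    using all h finite_X by (auto simp: card_le_Suc0_iff_eq)
  then show False
    using h min_rank_ge_2 unfolding minimal_maps_def by auto
qed

lemma finite_minimal_images: "finite minimal_images"
  using finite_X minimal_image_subset by (meson PowI finite_Pow_iff finite_subset subsetI)

lemma group_image_inj:
  assumes "g \<in> G"
  shows "inj_on (image g) minimal_images"
proof (rule inj_on_subset)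
  show "inj_on (image g) (Pow X)"
    using primitive_group_bij[OF primitive assms]
    by (intro inj_on_image_Pow) (rule bij_betw_imp_inj_on)
  show "minimal_images \<subseteq> Pow X"
    using minimal_image_subset by blast
qed

lemma degree_le:
  assumes "x \<in> X" "y \<in> X"
  shows "card {K \<in> minimal_images. x \<in> K} \<le> card {K \<in> minimal_images. y \<in> K}"
proof -
  obtain g where g: "g \<in> G" "g x = y"
    using primitive_group_transitive[OF primitive assms] by blast
  show ?thesis
  proof (rule card_inj_on_le)
    show "inj_on (image g) {K \<in> minimal_images. x \<in> K}"
      using group_image_inj[OF g(1)] by (rule inj_on_subset) blast
    show "image g ` {K \<in> minimal_images. x \<in> K} \<subseteq> {K \<in> minimal_images. y \<in> K}"
      using image_minimal_image[OF group_in_semigroup[OF g(1)]] g(2) by auto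
    show "finite {K \<in> minimal_images. y \<in> K}"
      using finite_minimal_images by simp
  qed
qed

lemma minimal_images_transversal_system:
  assumes "x \<in> X"
  shows "transversal_system X minimal_images minimal_maps (card {K \<in> minimal_images. x \<in> K})"
proof
  show "finite X" by (rule finite_X)
  show "K \<subseteq> X" if "K \<in> minimal_images" for K
    using that by (rule minimal_image_subset)
  show "inj_on h K" if "K \<in> minimal_images" "h \<in> minimal_maps" for K h
    using that inj_on_minimal_image unfolding minimal_maps_def by blast
  show "h ` K = h ` X" if "K \<in> minimal_images" "h \<in> minimal_maps" for K h
    using that by (intro minimal_map_onto)
  show "\<exists>h\<in>minimal_maps. h u \<noteq> h v" if "u \<in> X" "v \<in> X" "u \<noteq> v" for u v
    using that by (rule minimal_maps_separate)
  show "card {K \<in> minimal_images. u \<in> K} = card {K \<in> minimal_images. x \<in> K}" if "u \<in> X" for u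
    using degree_le[OF assms that] degree_le[OF that assms] by simp
  obtain h where h: "h \<in> minimal_maps"
    using minimal_map_exists by blast
  then have "h x \<in> X" "h ` X \<in> {K \<in> minimal_images. h x \<in> K}"
    using assms semigroup_maps unfolding minimal_images_def minimal_maps_def by auto
  then have "card {K \<in> minimal_images. h x \<in> K} > 0"
    using finite_minimal_images card_gt_0_iff by fastforce
  then show "card {K \<in> minimal_images. x \<in> K} > 0"
    using degree_le[OF \<open>h x \<in> X\<close> assms] by simp
qed

text \<open>
  Lying in the same minimal images is an invariant relation as well. Were it universal, the
  whole of \<open>X\<close> would be a minimal image, on which \<open>f\<close> must be injective.
\<close>

lemma minimal_images_distinguish:
  assumes "\<not> inj_on f X" and "x \<in> X" "y \<in> X" "x \<noteq> y"
  shows "\<exists>K\<in>minimal_images. \<not> (x \<in> K \<longleftrightarrow> y \<in> K)"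
proof (rule ccontr)
  assume same: "\<not> ?thesis"
  have all: "\<forall>K\<in>minimal_images. u \<in> K \<longleftrightarrow> v \<in> K" if "u \<in> X" "v \<in> X" for u v
  proof (rule primitive_group_relation[OF primitive,
          where R = "\<lambda>u v. \<forall>K\<in>minimal_images. u \<in> K \<longleftrightarrow> v \<in> K" and x = x and y = y])
    fix g u v
    assume g: "g \<in> G" and uv: "u \<in> X" "v \<in> X"
      and eq: "\<forall>K\<in>minimal_images. u \<in> K \<longleftrightarrow> v \<in> K"
    \<comment> \<open>A permutation of the finite family, so that the relation can be pulled back along \<open>g\<close>.\<close>
    have onto: "image g ` minimal_images = minimal_images"
      using finite_minimal_images image_minimal_image[OF group_in_semigroup[OF g]]
        group_image_inj[OF g] by (intro endo_inj_surj) auto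
    have mem: "g w \<in> g ` K \<longleftrightarrow> w \<in> K" if "w \<in> X" "K \<in> minimal_images" for w K
      using inj_on_image_mem_iff[OF bij_betw_imp_inj_on[OF primitive_group_bij[OF primitive g]]]
        that minimal_image_subset by blast
    show "\<forall>K\<in>minimal_images. g u \<in> K \<longleftrightarrow> g v \<in> K"
    proof
      fix K assume "K \<in> minimal_images"
      then obtain K' where "K' \<in> minimal_images" "K = g ` K'"
        using onto by (metis imageE)
      then show "g u \<in> K \<longleftrightarrow> g v \<in> K"
        using mem eq uv by simp
    qed
  qed (use assms same that in auto)
  obtain h where h: "h \<in> minimal_maps"
    using minimal_map_exists by blast
  then have K: "h ` X \<in> minimal_images"
    unfolding minimal_images_def by blast
  obtain w where w: "w \<in> h ` X"
    using nonempty_X by blast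
  have "h ` X = X"
    using all[of w] K w minimal_image_subset[OF K] by blast
  then have "inj_on f X"
    using inj_on_minimal_image[of f, OF _ K] by (simp add: generated_semigroup.generator)
  with assms(1) show False by blast
qed

end

section \<open>Kernel type with two non-singleton classes\<close>

lemma two_large_kernel_classes:
  assumes "finite X" and "kernel_type X f = {#p, q#} + replicate_mset k 1"
  shows "\<exists>A\<in>kernel_classes X f. \<exists>B\<in>kernel_classes X f. A \<noteq> B \<and> card A = p \<and> card B = q \<and>
    (\<forall>C\<in>kernel_classes X f. C \<noteq> A \<longrightarrow> C \<noteq> B \<longrightarrow> card C = 1)"
proof -
  let ?C = "kernel_classes X f"
  have fin: "finite ?C"
    using assms(1) by (simp add: kernel_classes_def)
  have "image_mset card (mset_set ?C) = add_mset p (add_mset q (replicate_mset k 1))"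
    using assms(2) by (simp add: kernel_type_def)
  then obtain M A where A: "mset_set ?C = add_mset A M" "card A = p"
    "image_mset card M = add_mset q (replicate_mset k 1)"
    by (auto dest!: msed_map_invR)
  then obtain N B where B: "M = add_mset B N" "card B = q"
    "image_mset card N = replicate_mset k 1"
    by (auto dest!: msed_map_invR)
  have eq: "mset_set ?C = add_mset A (add_mset B N)"
    using A(1) B(1) by simp
  have count: "count (mset_set ?C) C \<le> 1" for C
    by (simp add: count_mset_set')
  have "?C = set_mset (add_mset A (add_mset B N))"
    using fin unfolding eq[symmetric] by simp
  then have mem: "C \<in> ?C \<longleftrightarrow> C = A \<or> C = B \<or> C \<in># N" for C
    by simp
  \<comment> \<open>The classes form a set, so the two entries come from distinct classes even if \<open>p = q\<close>.\<close>
  have "A \<noteq> B"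
    using count[of A] unfolding eq by auto
  moreover have "card C = 1" if "C \<in> ?C" "C \<noteq> A" "C \<noteq> B" for C
  proof -
    have "card C \<in># image_mset card N"
      using mem that by simp
    then show ?thesis
      unfolding B(3) by (simp split: if_splits)
  qed
  ultimately show ?thesis
    using mem A(2) B(2) by blast
qed

theorem primitive_synchronizes_two_large_classes:
  assumes finX: "finite X" and prim: "primitive_permutation_group X G"
    and f: "f \<in> X \<rightarrow> X"
    and A: "A \<in> kernel_classes X f" "card A \<ge> 2"
    and B: "B \<in> kernel_classes X f" "card B \<ge> 2"
    and AB: "A \<noteq> B"
    and single: "\<And>C. C \<in> kernel_classes X f \<Longrightarrow> C \<noteq> A \<Longrightarrow> C \<noteq> B \<Longrightarrow> card C = 1"
  shows "synchronizes X G f"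
proof (rule ccontr)
  assume nosync: "\<not> synchronizes X G f"
  define fibre where "fibre x = {y \<in> X. f y = f x}" for x
  have fibre_class: "fibre x \<in> kernel_classes X f" if "x \<in> X" for x
    using that by (auto simp: fibre_def kernel_classes_def)
  have class_fibre: "C = fibre x" if "C \<in> kernel_classes X f" "x \<in> C" for C x
    using that by (auto simp: fibre_def kernel_classes_def)
  have sub: "A \<subseteq> X" "B \<subseteq> X"
    using A(1) B(1) by (auto simp: kernel_classes_def)
  have same: "f x = f y \<longleftrightarrow> x = y \<or> x \<in> A \<and> y \<in> A \<or> x \<in> B \<and> y \<in> B"
    if xy: "x \<in> X" "y \<in> X" for x y
  proof
    assume eq: "f x = f y"
    have x: "x \<in> fibre x" and y: "y \<in> fibre x"
      using xy eq by (auto simp: fibre_def)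
    consider "fibre x = A" | "fibre x = B" | "card (fibre x) = 1"
      using single[OF fibre_class[OF xy(1)]] by blast
    then show "x = y \<or> x \<in> A \<and> y \<in> A \<or> x \<in> B \<and> y \<in> B"
    proof cases
      case 3
      then obtain z where "fibre x = {z}"
        by (rule card_1_singletonE)
      then show ?thesis
        using x y by simp
    qed (use x y in simp_all)
  next
    assume "x = y \<or> x \<in> A \<and> y \<in> A \<or> x \<in> B \<and> y \<in> B"
    then show "f x = f y"
      using A(1) B(1) by (auto simp: kernel_classes_def)
  qed
  have disj: "A \<inter> B = {}"
    using class_fibre A(1) B(1) AB by blast
  obtain x where x: "x \<in> A"
    using other_element[OF A(2)] by blast
  obtain y where y: "y \<in> A" "y \<noteq> x"
    using other_element[OF A(2)] by blast
  interpret nonsynchronized_map X G f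
    by unfold_locales (use finX prim f nosync x sub in auto)
  have fS: "f \<in> semigroup"
    by (simp add: generated_semigroup.generator)
  have transversals:
    "transversal_system X minimal_images minimal_maps (card {K \<in> minimal_images. x \<in> K})"
    using x sub by (intro minimal_images_transversal_system) blast
  interpret two_fibre_map X minimal_images minimal_maps
    "card {K \<in> minimal_images. x \<in> K}" f A B
    by (intro two_fibre_map.intro two_fibre_map_axioms.intro)
      (fact transversals semigroup_maps[OF fS] image_minimal_image[OF fS]
        inj_on_minimal_image[OF fS] sub disj A(2) B(2) same)+
  obtain a b where ab: "a \<in> A" "b \<in> B" "\<forall>K\<in>minimal_images. a \<in> K \<longleftrightarrow> b \<in> K"
    using inseparable_pair by blast
  have "\<not> inj_on f X"
    using x y sub same[of x y] by (auto dest: inj_onD)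
  moreover have "a \<noteq> b"
    using ab disj by blast
  ultimately show False
    using minimal_images_distinguish[of a b] ab sub by blast
qed

theorem corollary5p4:
  fixes X :: "'a set" and G :: "('a \<Rightarrow> 'a) set" and p :: nat
  assumes "p \<ge> 3"
    and "finite X"
    and "primitive_permutation_group X G"
  shows "\<forall>f \<in> X \<rightarrow>\<^sub>E X.
           (\<exists>k. kernel_type X f = {#p, 3#} + replicate_mset k 1) \<longrightarrow> synchronizes X G f"
proof (intro ballI impI)
  fix f assume f: "f \<in> X \<rightarrow>\<^sub>E X"
    and "\<exists>k. kernel_type X f = {#p, 3#} + replicate_mset k 1"
  then obtain k where "kernel_type X f = {#p, 3#} + replicate_mset k 1"
    by blast
  from two_large_kernel_classes[OF assms(2) this] obtain A B where
    "A \<in> kernel_classes X f" "B \<in> kernel_classes X f" "A \<noteq> B" "card A = p" "card B = 3"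
    "\<forall>C\<in>kernel_classes X f. C \<noteq> A \<longrightarrow> C \<noteq> B \<longrightarrow> card C = 1"
    by blast
  moreover have "f \<in> X \<rightarrow> X"
    using f by (simp add: PiE_def)
  ultimately show "synchronizes X G f"
    using assms(1) primitive_synchronizes_two_large_classes[OF assms(2,3), of f A B] by simp
qed

end
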